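(* For every integer $n\ge 2$ there exist a compact metric space $(X,d)$ and a homeomorphism $f\colon X\to X$ such that $f$ is $n$-expansive, $f$ is not $(n-1)$-expansive, $f$ has the shadowing property, and $f$ admits infinitely many (distinct) chain-recurrent classes.
   Context: Let $f\colon X\to X$ be a homeomorphism of a metric space $(X,d)$. $n$-expansive: for a positive integer $n$, $f$ is $n$-expansive if there exists $c>0$ such that for every $x\in X$ the set $\Gamma(x,c)=\{y\in X : d(f^k(x),f^k(y))\le c \text{ for all } k\in\mathbb{Z}\}$ contains at most $n$ different points. Shadowing property: a sequence $(x_k)_{k\in\mathbb{Z}}\subset X$ is a $\delta$-pseudo-orbit if $d(f(x_k),x_{k+1})<\delta$ for all $k\in\mathbb{Z}$; it is $\varepsilon$-shadowed if there is $y\in X$ with $d(f^k(y),x_k)<\varepsilon$ for all $k\in\mathbb{Z}$. $f$ has the shadowing property if for every $\varepsilon>0$ there is $\delta>0$ such that every $\delta$-pseudo-orbit is $\varepsilon$-shadowed. Chain-recurrent class: the chain-recurrent class of $x\in X$ is the set of all $y\in X$ such that for every $\varepsilon>0$ there exist a finite $\varepsilon$-pseudo-orbit starting at $x$ and ending at $y$ and another one starting at $y$ and ending at $x$. Here a finite $\varepsilon$-pseudo-orbit is a finite sequence $x_0,\dots,x_m$ with $m\ge 1$ and $d(f(x_i),x_{i+1})<\varepsilon$ for $0\le i<m$. *)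

theory Defs
  imports "HOL-Analysis.Analysis"
begin

text \<open>
  Metric spaces are elements of the library type \<open>'a metric\<close>, with points \<open>mspace X\<close>, distance
  \<open>mdist X\<close> and topology \<open>mtopology_of X\<close>. Maps are total functions on \<open>'a\<close> of which only
  the restriction to \<open>mspace X\<close> matters.
\<close>

text \<open>The iterate \<open>f\<^sup>k\<close> for \<open>k \<in> \<int>\<close>, meaningful when \<open>f\<close> is a bijection of \<open>mspace X\<close> onto itself.\<close>

definition int_iterate :: "'a metric \<Rightarrow> ('a \<Rightarrow> 'a) \<Rightarrow> int \<Rightarrow> 'a \<Rightarrow> 'a" where
  "int_iterate X f k =
     (if k \<ge> 0 then f ^^ nat k else inv_into (mspace X) f ^^ nat (- k))"

definition homeomorphism_of :: "'a metric \<Rightarrow> ('a \<Rightarrow> 'a) \<Rightarrow> bool" where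
  "homeomorphism_of X f \<longleftrightarrow> homeomorphic_map (mtopology_of X) (mtopology_of X) f"

definition dynamical_ball :: "'a metric \<Rightarrow> ('a \<Rightarrow> 'a) \<Rightarrow> 'a \<Rightarrow> real \<Rightarrow> 'a set" where
  "dynamical_ball X f x c =
     {y \<in> mspace X. \<forall>k::int. mdist X (int_iterate X f k x) (int_iterate X f k y) \<le> c}"

definition n_expansive :: "nat \<Rightarrow> 'a metric \<Rightarrow> ('a \<Rightarrow> 'a) \<Rightarrow> bool" where
  "n_expansive n X f \<longleftrightarrow>
     (\<exists>c>0. \<forall>x\<in>mspace X. finite (dynamical_ball X f x c) \<and> card (dynamical_ball X f x c) \<le> n)"

definition pseudo_orbit :: "'a metric \<Rightarrow> ('a \<Rightarrow> 'a) \<Rightarrow> real \<Rightarrow> (int \<Rightarrow> 'a) \<Rightarrow> bool" where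
  "pseudo_orbit X f \<delta> s \<longleftrightarrow>
     (\<forall>k. s k \<in> mspace X) \<and> (\<forall>k. mdist X (f (s k)) (s (k + 1)) < \<delta>)"

definition shadowed :: "'a metric \<Rightarrow> ('a \<Rightarrow> 'a) \<Rightarrow> real \<Rightarrow> (int \<Rightarrow> 'a) \<Rightarrow> bool" where
  "shadowed X f \<epsilon> s \<longleftrightarrow> (\<exists>y\<in>mspace X. \<forall>k. mdist X (int_iterate X f k y) (s k) < \<epsilon>)"

definition shadowing_property :: "'a metric \<Rightarrow> ('a \<Rightarrow> 'a) \<Rightarrow> bool" where
  "shadowing_property X f \<longleftrightarrow>
     (\<forall>\<epsilon>>0. \<exists>\<delta>>0. \<forall>s. pseudo_orbit X f \<delta> s \<longrightarrow> shadowed X f \<epsilon> s)"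

definition finite_pseudo_orbit ::
  "'a metric \<Rightarrow> ('a \<Rightarrow> 'a) \<Rightarrow> real \<Rightarrow> nat \<Rightarrow> (nat \<Rightarrow> 'a) \<Rightarrow> bool" where
  "finite_pseudo_orbit X f \<epsilon> m s \<longleftrightarrow>
     m \<ge> 1 \<and> (\<forall>i\<le>m. s i \<in> mspace X) \<and> (\<forall>i<m. mdist X (f (s i)) (s (i + 1)) < \<epsilon>)"

definition chains_to :: "'a metric \<Rightarrow> ('a \<Rightarrow> 'a) \<Rightarrow> real \<Rightarrow> 'a \<Rightarrow> 'a \<Rightarrow> bool" where
  "chains_to X f \<epsilon> x y \<longleftrightarrow> (\<exists>m s. finite_pseudo_orbit X f \<epsilon> m s \<and> s 0 = x \<and> s m = y)"

text \<open>The class of a point that is not chain recurrent is the empty set.\<close>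

definition chain_recurrent_class :: "'a metric \<Rightarrow> ('a \<Rightarrow> 'a) \<Rightarrow> 'a \<Rightarrow> 'a set" where
  "chain_recurrent_class X f x =
     {y \<in> mspace X. \<forall>\<epsilon>>0. chains_to X f \<epsilon> x y \<and> chains_to X f \<epsilon> y x}"

text \<open>
  A metric space with at most continuum many points, in particular every compact one, is isometric
  to an element of \<open>real metric\<close>: the points are used only as labels, and \<open>mdist\<close> is
  unrelated to the usual distance on the reals. Existence of a compact metric space can therefore
  be stated with \<open>real metric\<close> without loss of generality.
\<close>

end

theory Submission
  imports Defs
begin

text \<open>
  The full two-sided shift on two symbols is expansive and has the shadowing property. It keeps
  shadowing, but acquires small dynamical balls of exactly \<open>n\<close> points and infinitely many
  chain-recurrent classes, when more and more of its periodic orbits are replaced by a stack of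
  \<open>n\<close> parallel copies whose mutual distances tend to \<open>0\<close> from one orbit to the next.

  Let \<open>N = n - 1\<close> and let \<open>O\<^sub>q\<close> be the orbit of the sequence with a single \<open>True\<close> in each period
  of length \<open>q\<close>. A point is a pair \<open>(x, a)\<close> of a sequence \<open>x\<close> and a level \<open>a \<in> \<nat>\<close>. At level \<open>0\<close>
  every sequence occurs; the positive levels are grouped into consecutive blocks of length \<open>N\<close>,
  and at a level of the \<open>q\<close>-th block only the sequences of \<open>O\<^sub>q\<close> occur. The map shifts \<open>x\<close> and
  keeps \<open>a\<close>. Two points are \<open>1 / m\<close>-close when their sequences agree on \<open>]-m, m[\<close> and their levels
  agree once all levels beyond \<open>m\<close> are identified with level \<open>0\<close>; thus level \<open>a\<close> converges to
  level \<open>0\<close> as \<open>a\<close> grows, while every positive level is isolated.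

  The key observation is \<open>near_imp_eq\<close>: the period of the orbit at level \<open>a\<close> is at most \<open>a\<close>, so at
  scale \<open>1 / a\<close> the points of level \<open>a\<close> are already isolated. This gives:

  \<^item> Compactness: a Cauchy sequence is eventually constant, or converges to a point of level \<open>0\<close>.
  \<^item> Expansivity: a dynamical ball of radius \<open>1 / 2\<close> consists of points over one sequence, of which
    there are at most \<open>N + 1\<close> because the orbits \<open>O\<^sub>q\<close> are disjoint. Over \<open>O\<^sub>q\<close> with \<open>q\<close> large there
    are exactly \<open>N + 1\<close> levels, all as close together as desired.
  \<^item> Shadowing: a \<open>1 / m\<close>-pseudo-orbit that meets a level in \<open>[1, m]\<close> is a true orbit; at this scale
    any other is indistinguishable from one at level \<open>0\<close> and is shadowed as in the full shift.
  \<^item> Chain classes: a fine enough pseudo-orbit cannot leave a positive level, and every point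
    there is periodic, so distinct positive levels contribute distinct classes.

  The construction is carried out on an arbitrary carrier set equipped with a coding by such
  pairs, so that it applies verbatim to a set of real numbers serving as labels.
\<close>

section \<open>Periodic sequences and their codes\<close>

definition spikes :: "nat \<Rightarrow> (int \<Rightarrow> bool) set" where
  "spikes q = {x. \<exists>j. \<forall>i. x i \<longleftrightarrow> int q dvd i - j}"

lemma spikes_nonempty: "(\<lambda>i. int q dvd i) \<in> spikes q"
  by (auto simp: spikes_def intro!: exI[of _ 0])

lemma spikes_shift:
  assumes "x \<in> spikes q"
  shows "(\<lambda>i. x (i + k)) \<in> spikes q"
proof -
  obtain j where "\<And>i. x i \<longleftrightarrow> int q dvd i - j"
    using assms by (auto simp: spikes_def)
  then have "\<forall>i. x (i + k) \<longleftrightarrow> int q dvd i - (j - k)"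
    by (simp add: algebra_simps)
  then show ?thesis
    unfolding spikes_def by blast
qed

lemma spikes_cong:
  assumes "x \<in> spikes q" "int q dvd i - i'"
  shows "x i = x i'"
proof -
  obtain j where j: "\<And>i. x i \<longleftrightarrow> int q dvd i - j"
    using assms by (auto simp: spikes_def)
  have "i - j = (i - i') + (i' - j)"
    by simp
  then show ?thesis
    unfolding j using assms(2) dvd_add_right_iff by metis
qed

text \<open>
  The positions of \<open>True\<close> are a coset of \<open>q\<int>\<close>, so their differences determine \<open>q\<close>.
\<close>

lemma spikes_disjoint:
  assumes "x \<in> spikes q" "x \<in> spikes r"
  shows "q = r"
proof -
  obtain j where j: "\<And>i. x i \<longleftrightarrow> int q dvd i - j"
    using assms by (auto simp: spikes_def)
  obtain l where l: "\<And>i. x i \<longleftrightarrow> int r dvd i - l"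
    using assms by (auto simp: spikes_def)
  have "x j" "x (j + int q)" "x l" "x (l + int r)"
    unfolding j by (simp, simp) (simp_all flip: j add: l)
  then have "int r dvd j - l" "int r dvd j + int q - l" "int q dvd l - j" "int q dvd l + int r - j"
    using j l by auto
  moreover have "int q = (j + int q - l) - (j - l)" "int r = (l + int r - j) - (l - j)"
    by auto
  ultimately have "int r dvd int q" "int q dvd int r"
    by (metis dvd_diff)+
  then show ?thesis
    by (simp add: dvd_antisym)
qed

lemma spikes_eq_if_window_eq:
  assumes "x \<in> spikes q" "y \<in> spikes q" "1 \<le> q" "q \<le> m"
    and "\<And>i. \<bar>i\<bar> < int m \<Longrightarrow> x i = y i"
  shows "x = y"
proof
  fix i
  \<comment> \<open>The window contains the full period \<open>[0, q[\<close>, as \<open>q \<le> m\<close>.\<close>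
  have "int q dvd i - i mod int q"
    by (simp add: minus_mod_eq_mult_div)
  moreover have "0 \<le> i mod int q" "i mod int q < int m"
    using assms(3,4) pos_mod_bound[of "int q" i] by (simp_all, linarith)
  ultimately show "x i = y i"
    using spikes_cong[OF assms(1)] spikes_cong[OF assms(2)] assms(5)[of "i mod int q"] by fastforce
qed

text \<open>
  The block of the positive level \<open>a\<close> is \<open>(a - 1) div N + 1\<close>, counted from \<open>1\<close> so that it can serve
  as the period of the orbit placed at that level.
\<close>

definition codes :: "nat \<Rightarrow> ((int \<Rightarrow> bool) \<times> nat) set" where
  "codes N = {(x, a). a = 0 \<or> x \<in> spikes ((a - 1) div N + 1)}"

text \<open>
  A sequence lies in at most one of the disjoint periodic orbits, hence over it there are level \<open>0\<close>
  and at most one block of \<open>N\<close> levels.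
\<close>

lemma levels_over_sequence:
  assumes "N \<ge> 1"
  shows "finite {a. (x, a) \<in> codes N} \<and> card {a. (x, a) \<in> codes N} \<le> N + 1"
proof -
  obtain k where k: "{a. (x, a) \<in> codes N} \<subseteq> insert 0 {k * N + 1..k * N + N}"
  proof (cases "\<exists>k. x \<in> spikes (k + 1)")
    case True
    then obtain k where k: "x \<in> spikes (k + 1)" by blast
    have "a \<in> {k * N + 1..k * N + N}" if "(x, a) \<in> codes N" "a \<noteq> 0" for a
    proof -
      have "(a - 1) div N = k"
        using that spikes_disjoint[OF k] by (auto simp: codes_def)
      then have "k * N + (a - 1) mod N = a - 1"
        using div_mult_mod_eq[of "a - 1" N] by simp
      moreover have "(a - 1) mod N < N"
        using assms by simp
      ultimately have "k * N \<le> a - 1" "a - 1 < k * N + N"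
        by linarith+
      then show ?thesis
        using \<open>a \<noteq> 0\<close> by auto
    qed
    then show ?thesis
      using that by blast
  next
    case False
    then show ?thesis
      using that[of 0] by (auto simp: codes_def)
  qed
  have "card (insert 0 {k * N + 1..k * N + N}) = N + 1"
    by simp
  then show ?thesis
    using k card_mono[OF _ k] finite_subset[OF k] by auto
qed

section \<open>The stacked shift and its metric\<close>

text \<open>
  A point \<open>p\<close> stands for the pair of its itinerary \<open>itin p\<close> and its level \<open>lev p\<close>.
\<close>

locale stacked_shift =
  fixes N :: nat and S :: "'a set"
    and itin :: "'a \<Rightarrow> int \<Rightarrow> bool" and lev :: "'a \<Rightarrow> nat" and f :: "'a \<Rightarrow> 'a"
  assumes N_pos: "N \<ge> 1"
    and coding: "bij_betw (\<lambda>p. (itin p, lev p)) S (codes N)"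
    and f_in: "p \<in> S \<Longrightarrow> f p \<in> S"
    and itin_f: "p \<in> S \<Longrightarrow> itin (f p) i = itin p (i + 1)"
    and lev_f: "p \<in> S \<Longrightarrow> lev (f p) = lev p"
begin

lemma point_eqI:
  assumes "p \<in> S" "r \<in> S" "\<And>i. itin p i = itin r i" "lev p = lev r"
  shows "p = r"
proof -
  have "itin p = itin r"
    using assms(3) by blast
  then show ?thesis
    using assms coding by (auto simp: bij_betw_def inj_on_def)
qed

lemma code_in: "p \<in> S \<Longrightarrow> (itin p, lev p) \<in> codes N"
  using coding by (auto simp: bij_betw_def)

lemma point_exists:
  assumes "(x, a) \<in> codes N"
  obtains p where "p \<in> S" "itin p = x" "lev p = a"
  using coding assms by (force simp: bij_betw_def)

definition height :: "nat \<Rightarrow> nat \<Rightarrow> nat" where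
  "height m a = (if a \<le> m then a else 0)"

definition near :: "nat \<Rightarrow> 'a \<Rightarrow> 'a \<Rightarrow> bool" where
  "near m p r \<longleftrightarrow> (\<forall>i. \<bar>i\<bar> < int m \<longrightarrow> itin p i = itin r i) \<and> height m (lev p) = height m (lev r)"

text \<open>
  The ultrametric induced by the decreasing relations \<open>near m\<close>, scaled so that being closer than
  \<open>1 / m\<close> is the same as \<open>near m\<close>. From there on the metric enters only through this equivalence.
\<close>

definition gap :: "'a \<Rightarrow> 'a \<Rightarrow> real" where
  "gap p r = (if p = r then 0 else 1 / real (LEAST m. \<not> near m p r))"

lemma near_refl: "near m p p"
  by (simp add: near_def)

lemma near_commute: "near m p r \<longleftrightarrow> near m r p"
  by (auto simp: near_def)

lemma near_trans: "near m p r \<Longrightarrow> near m r s \<Longrightarrow> near m p s"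
  by (auto simp: near_def)

lemma near_antimono: "near m p r \<Longrightarrow> k \<le> m \<Longrightarrow> near k p r"
  by (fastforce simp: near_def height_def split: if_splits)

lemma near_0: "near 0 p r"
  by (simp add: near_def height_def)

lemma near_all_imp_eq:
  assumes "p \<in> S" "r \<in> S" "\<And>m. near m p r"
  shows "p = r"
proof (rule point_eqI[OF assms(1,2)])
  show "itin p i = itin r i" for i
    using assms(3)[of "nat \<bar>i\<bar> + 1"] by (auto simp: near_def)
  show "lev p = lev r"
    using assms(3)[of "lev p + lev r"] by (auto simp: near_def height_def)
qed

lemma gap_cases:
  assumes "p \<in> S" "r \<in> S"
  obtains "p = r" "gap p r = 0"
    | L where "L \<ge> 1" "gap p r = 1 / real L" "\<And>m. near m p r \<longleftrightarrow> m < L"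
proof (cases "p = r")
  case False
  define L where "L = (LEAST m. \<not> near m p r)"
  have "\<exists>m. \<not> near m p r"
    using False assms near_all_imp_eq by blast
  then have L: "\<not> near L p r"
    unfolding L_def by (rule LeastI_ex)
  then have "L \<ge> 1"
    using near_0 by (cases L) auto
  moreover have "near m p r \<longleftrightarrow> m < L" for m
    using L near_antimono not_less_Least[of m "\<lambda>m. \<not> near m p r"]
    unfolding L_def by (metis linorder_not_le)
  moreover have "gap p r = 1 / real L"
    using False by (simp add: gap_def L_def)
  ultimately show ?thesis
    using that(2) by blast
qed (use that in \<open>simp add: gap_def\<close>)

lemma gap_less_iff:
  assumes "p \<in> S" "r \<in> S" "m \<ge> 1"
  shows "gap p r < 1 / real m \<longleftrightarrow> near m p r"
  using assms(1,2)
proof (cases rule: gap_cases)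
  case 1
  then show ?thesis
    using assms by (simp add: near_refl)
next
  case (2 L)
  have "1 / real L < 1 / real m \<longleftrightarrow> m < L"
    using 2(1) assms(3) by (simp add: field_simps)
  then show ?thesis
    using 2(2,3) by simp
qed

lemma gap_nonneg: "0 \<le> gap p r"
  by (simp add: gap_def)

sublocale Metric_space S gap
proof
  show "0 \<le> gap p r" for p r
    by (rule gap_nonneg)
  show "gap p r = gap r p" for p r
    using near_commute[of _ p r] by (simp add: gap_def)
  show "gap p r = 0 \<longleftrightarrow> p = r" if "p \<in> S" "r \<in> S" for p r
    using that
  proof (cases rule: gap_cases)
    case (2 L)
    then have "p \<noteq> r"
      using near_refl[of L p] by blast
    with 2(1,2) show ?thesis
      by simp
  qed simp
  show "gap p s \<le> gap p r + gap r s" if "p \<in> S" "r \<in> S" "s \<in> S" for p r s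
    using \<open>p \<in> S\<close> \<open>s \<in> S\<close>
  proof (cases rule: gap_cases)
    case 1
    then show ?thesis
      by (simp add: gap_nonneg)
  next
    case (2 L)
    have "\<not> near L p r \<or> \<not> near L r s"
      using near_trans[of L p r s] 2(3)[of L] by blast
    then have "1 / real L \<le> gap p r \<or> 1 / real L \<le> gap r s"
      using gap_less_iff[of p r L] gap_less_iff[of r s L] 2(1) that by linarith
    then show ?thesis
      using gap_nonneg[of p r] gap_nonneg[of r s] 2(2) by linarith
  qed
qed

definition stacked_space :: "'a metric" where
  "stacked_space = metric (S, gap)"

lemma mspace_stacked_space [simp]: "mspace stacked_space = S"
  and mdist_stacked_space [simp]: "mdist stacked_space = gap"
  and mtopology_stacked_space: "mtopology_of stacked_space = mtopology"
  by (simp_all add: stacked_space_def)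

lemma scale_exists:
  assumes "(\<epsilon>::real) > 0"
  obtains m where "m \<ge> 1" "1 / real m < \<epsilon>"
proof -
  obtain k where "inverse (real (Suc k)) < \<epsilon>"
    using reals_Archimedean assms by blast
  then show ?thesis
    using that[of "Suc k"] by (simp add: inverse_eq_divide)
qed

text \<open>
  Positive levels are isolated, and the period at level \<open>a\<close> is at most \<open>a\<close>, so a window of
  radius \<open>m \<ge> a\<close> determines the whole sequence there. That one scale \<open>m\<close> serves both purposes
  is what lets shadowing hold with equal accuracy and tolerance.
\<close>

lemma near_imp_eq:
  assumes "p \<in> S" "r \<in> S" "near m p r" "1 \<le> lev p" "lev p \<le> m"
  shows "p = r"
proof (rule point_eqI[OF assms(1,2)])
  show lev: "lev p = lev r"
    using assms by (auto simp: near_def height_def split: if_splits)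
  let ?q = "(lev p - 1) div N + 1"
  have "?q \<le> m"
    using assms(4,5) div_le_dividend[of "lev p - 1" N] by linarith
  moreover have "itin p \<in> spikes ?q" "itin r \<in> spikes ?q"
    using code_in[OF assms(1)] code_in[OF assms(2)] lev assms(4) by (auto simp: codes_def)
  ultimately have "itin p = itin r"
    using assms(3) by (intro spikes_eq_if_window_eq[of _ ?q _ m]) (auto simp: near_def)
  then show "itin p i = itin r i" for i
    by simp
qed

section \<open>Compactness\<close>

text \<open>
  At scale \<open>1 / m\<close> a point is described by its window and its truncated level, which leaves finitely
  many possibilities.
\<close>

lemma mtotally_bounded_S: "mtotally_bounded S"
  unfolding mtotally_bounded_def
proof (intro allI impI)
  fix \<epsilon> :: real
  assume "\<epsilon> > 0"
  then obtain m where m: "m \<ge> 1" "1 / real m < \<epsilon>"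
    by (rule scale_exists)
  define view where "view p = ({i. \<bar>i\<bar> < int m \<and> itin p i}, height m (lev p))" for p
  have "view ` S \<subseteq> Pow {- int m..int m} \<times> {..m}"
    by (auto simp: view_def height_def)
  then have "finite (view ` S)"
    by (rule finite_subset) simp
  then obtain K where K: "K \<subseteq> S" "finite K" "view ` S = view ` K"
    using finite_subset_image[of "view ` S" view S] by auto
  have "S \<subseteq> (\<Union>x\<in>K. mball x \<epsilon>)"
  proof
    fix p
    assume p: "p \<in> S"
    then obtain r where r: "r \<in> K" "view p = view r"
      using K(3) by (metis imageE imageI)
    then have "near m r p"
      by (auto simp: near_def view_def set_eq_iff)
    then have "gap r p < \<epsilon>"
      using gap_less_iff[of r p m] m p r K(1) by force
    then show "p \<in> (\<Union>x\<in>K. mball x \<epsilon>)"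
      using p r K(1) by auto
  qed
  with K show "\<exists>K. finite K \<and> K \<subseteq> S \<and> S \<subseteq> (\<Union>x\<in>K. mball x \<epsilon>)"
    by blast
qed

lemma limitin_if_near:
  assumes "l \<in> S" "\<And>j. \<sigma> j \<in> S"
    and "\<And>m. m \<ge> 1 \<Longrightarrow> \<exists>J. \<forall>j\<ge>J. near m (\<sigma> j) l"
  shows "limitin mtopology \<sigma> l sequentially"
  unfolding limit_metric_sequentially
proof (intro conjI allI impI)
  fix \<epsilon> :: real
  assume "\<epsilon> > 0"
  then obtain m where m: "m \<ge> 1" "1 / real m < \<epsilon>"
    by (rule scale_exists)
  then show "\<exists>J. \<forall>j\<ge>J. \<sigma> j \<in> S \<and> gap (\<sigma> j) l < \<epsilon>"
    using assms gap_less_iff by (meson less_trans)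
qed (rule assms)

lemma mcomplete_S: mcomplete
  unfolding mcomplete_def
proof (intro allI impI)
  fix \<sigma>
  assume "MCauchy \<sigma>"
  then have in_S: "\<sigma> j \<in> S" for j
    by (auto simp: MCauchy_def)
  have "\<exists>J. \<forall>j l. J \<le> j \<longrightarrow> J \<le> l \<longrightarrow> near m (\<sigma> j) (\<sigma> l)" for m
  proof (cases "m = 0")
    case False
    then have "\<exists>J. \<forall>j l. J \<le> j \<longrightarrow> J \<le> l \<longrightarrow> gap (\<sigma> j) (\<sigma> l) < 1 / real m"
      using \<open>MCauchy \<sigma>\<close> by (simp add: MCauchy_def)
    then show ?thesis
      using False in_S by (simp add: gap_less_iff)
  qed (simp add: near_0)
  then obtain J where J: "\<And>m j l. J m \<le> j \<Longrightarrow> J m \<le> l \<Longrightarrow> near m (\<sigma> j) (\<sigma> l)"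
    by metis
  show "\<exists>l. limitin mtopology \<sigma> l sequentially"
  proof (cases "\<exists>m. height m (lev (\<sigma> (J m))) \<noteq> 0")
    case True
    then obtain m where "height m (lev (\<sigma> (J m))) \<noteq> 0" ..
    then have m: "1 \<le> lev (\<sigma> (J m))" "lev (\<sigma> (J m)) \<le> m"
      by (auto simp: height_def split: if_splits)
    then have "\<sigma> j = \<sigma> (J m)" if "J m \<le> j" for j
      using near_imp_eq[of "\<sigma> (J m)" "\<sigma> j" m] J[of m "J m" j] in_S that by simp
    then have "\<forall>j\<ge>J m. near k (\<sigma> j) (\<sigma> (J m))" for k
      using near_refl by metis
    then have "limitin mtopology \<sigma> (\<sigma> (J m)) sequentially"
      using in_S limitin_if_near by blast
    then show ?thesis ..
  next
    case False
    \<comment> \<open>No bounded level persists, so the limit has level \<open>0\<close>, where every sequence is available.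
       The entry at \<open>i\<close> is stable once the scale exceeds \<open>\<bar>i\<bar>\<close>.\<close>
    define x where "x i = itin (\<sigma> (J (nat \<bar>i\<bar> + 1))) i" for i
    obtain l where l: "l \<in> S" "itin l = x" "lev l = 0"
      using point_exists[of x 0] by (auto simp: codes_def)
    have "near m (\<sigma> j) l" if "j \<ge> J m" for m j
      unfolding near_def
    proof (intro conjI allI impI)
      fix i :: int
      assume i: "\<bar>i\<bar> < int m"
      let ?m = "nat \<bar>i\<bar> + 1"
      \<comment> \<open>Compare both indices with one that is late enough for the two scales.\<close>
      have "near m (\<sigma> j) (\<sigma> (max (J m) (J ?m)))" "near ?m (\<sigma> (max (J m) (J ?m))) (\<sigma> (J ?m))"
        using J that by auto
      then show "itin (\<sigma> j) i = itin l i"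
        using i by (auto simp: near_def l x_def)
    next
      show "height m (lev (\<sigma> j)) = height m (lev l)"
        using J[OF that order_refl] False by (auto simp: near_def l height_def)
    qed
    then have "limitin mtopology \<sigma> l sequentially"
      using l in_S by (intro limitin_if_near) blast+
    then show ?thesis ..
  qed
qed

lemma compact_mtopology: "compact_space mtopology"
  using compact_space_eq_mcomplete_mtotally_bounded mcomplete_S mtotally_bounded_S by blast

section \<open>The homeomorphism and its iterates\<close>

lemma bij_f: "bij_betw f S S"
proof (rule bij_betwI')
  fix p r
  assume pr: "p \<in> S" "r \<in> S"
  show "f p = f r \<longleftrightarrow> p = r"
  proof
    assume eq: "f p = f r"
    have "itin p i = itin r i" for i
      using itin_f[OF pr(1), of "i - 1"] itin_f[OF pr(2), of "i - 1"] eq by simp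
    then show "p = r"
      using point_eqI[OF pr] lev_f pr eq by metis
  qed simp
next
  fix r
  assume r: "r \<in> S"
  have "(\<lambda>i. itin r (i + (- 1)), lev r) \<in> codes N"
    using code_in[OF r] spikes_shift[of "itin r" _ "- 1"] by (auto simp: codes_def)
  then obtain p where p: "p \<in> S" "itin p = (\<lambda>i. itin r (i + (- 1)))" "lev p = lev r"
    by (rule point_exists)
  then have "f p = r"
    using r by (intro point_eqI) (auto simp: f_in itin_f lev_f)
  with p show "\<exists>p\<in>S. r = f p"
    by blast
qed (rule f_in)

lemma homeomorphic_map_f: "homeomorphic_map mtopology mtopology f"
proof (rule continuous_imp_homeomorphic_map)
  show "continuous_map mtopology mtopology f"
    unfolding metric_continuous_map[OF Metric_space_axioms]
  proof (intro conjI ballI allI impI)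
    fix p and \<epsilon> :: real
    assume p: "p \<in> S" and "\<epsilon> > 0"
    then obtain m where m: "m \<ge> 1" "1 / real m < \<epsilon>"
      using scale_exists by blast
    have "gap (f p) (f r) < \<epsilon>" if r: "r \<in> S" "gap p r < 1 / real (m + 1)" for r
    proof -
      have "near (m + 1) p r"
        using gap_less_iff[of p r "m + 1"] p r by simp
      then have "near m (f p) (f r)"
        using p r by (auto simp: near_def itin_f lev_f height_def split: if_splits)
      then show ?thesis
        using gap_less_iff[of "f p" "f r" m] p r m f_in by fastforce
    qed
    then show "\<exists>\<delta>>0. \<forall>r. r \<in> S \<and> gap p r < \<delta> \<longrightarrow> gap (f p) (f r) < \<epsilon>"
      by (intro exI[of _ "1 / real (m + 1)"]) auto
  qed (use f_in in blast)
qed (use bij_f compact_mtopology Hausdorff_space_mtopology in \<open>auto simp: bij_betw_def\<close>)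

lemma inv_into_f:
  assumes "p \<in> S"
  shows "inv_into S f p \<in> S" "itin (inv_into S f p) i = itin p (i - 1)" "lev (inv_into S f p) = lev p"
proof -
  let ?r = "inv_into S f p"
  have p: "p \<in> f ` S"
    using bij_f assms by (simp add: bij_betw_def)
  show r: "?r \<in> S"
    using inv_into_into[OF p] .
  show "itin ?r i = itin p (i - 1)" "lev ?r = lev p"
    using itin_f[OF r, of "i - 1"] lev_f[OF r] f_inv_into_f[OF p] by simp_all
qed

lemma funpow_f:
  assumes "p \<in> S"
  shows "(f ^^ k) p \<in> S \<and> (\<forall>i. itin ((f ^^ k) p) i = itin p (i + int k)) \<and> lev ((f ^^ k) p) = lev p"
  by (induction k) (use assms in \<open>auto simp: f_in itin_f lev_f algebra_simps\<close>)

lemma funpow_inv_into_f: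
  assumes "p \<in> S"
  shows "(inv_into S f ^^ k) p \<in> S \<and>
    (\<forall>i. itin ((inv_into S f ^^ k) p) i = itin p (i - int k)) \<and> lev ((inv_into S f ^^ k) p) = lev p"
  by (induction k) (use assms in \<open>auto simp: inv_into_f algebra_simps\<close>)

lemma iterate_f:
  assumes "p \<in> S"
  shows iterate_in: "int_iterate stacked_space f k p \<in> S"
    and itin_iterate: "itin (int_iterate stacked_space f k p) i = itin p (i + k)"
    and lev_iterate: "lev (int_iterate stacked_space f k p) = lev p"
  using funpow_f[OF assms, of "nat k"] funpow_inv_into_f[OF assms, of "nat (- k)"]
  by (auto simp: int_iterate_def)

section \<open>Expansivity\<close>

text \<open>
  Being \<open>1 / 2\<close>-close forces agreement at coordinate \<open>0\<close>. Doing so along the whole orbit reads off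
  the entire sequence, hence only the level remains free.
\<close>

lemma n_expansive_stacked: "n_expansive (N + 1) stacked_space f"
  unfolding n_expansive_def
proof (intro exI[of _ "1 / 2"] conjI ballI)
  fix p
  assume "p \<in> mspace stacked_space"
  then have p: "p \<in> S"
    by simp
  let ?B = "dynamical_ball stacked_space f p (1 / 2)"
  have same_itin: "itin r = itin p" if "r \<in> ?B" for r
  proof
    fix k
    have r: "r \<in> S" and le: "gap (int_iterate stacked_space f k p) (int_iterate stacked_space f k r) \<le> 1 / 2"
      using that by (auto simp: dynamical_ball_def)
    from le have "near 1 (int_iterate stacked_space f k p) (int_iterate stacked_space f k r)"
      using gap_less_iff[of "int_iterate stacked_space f k p" "int_iterate stacked_space f k r" 1] p r iterate_in
      by simp
    then have "itin (int_iterate stacked_space f k p) 0 = itin (int_iterate stacked_space f k r) 0"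
      by (simp add: near_def)
    then show "itin r k = itin p k"
      by (simp add: itin_iterate p r)
  qed
  have sub: "?B \<subseteq> S"
    by (auto simp: dynamical_ball_def)
  have inj: "inj_on lev ?B"
  proof (rule inj_onI)
    fix r s
    assume "r \<in> ?B" "s \<in> ?B" "lev r = lev s"
    then show "r = s"
      using point_eqI[of r s] same_itin[of r] same_itin[of s] sub by auto
  qed
  let ?L = "{a. (itin p, a) \<in> codes N}"
  have "lev ` ?B \<subseteq> ?L"
    using code_in same_itin sub by fastforce
  moreover have "finite ?L" "card ?L \<le> N + 1"
    using levels_over_sequence[OF N_pos, of "itin p"] by auto
  ultimately have "finite (lev ` ?B)" "card (lev ` ?B) \<le> N + 1"
    using finite_subset[of "lev ` ?B" ?L] card_mono[of ?L "lev ` ?B"] by linarith+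
  then show "finite ?B" "card ?B \<le> N + 1"
    using inj by (simp_all add: finite_image_iff card_image)
qed simp

text \<open>
  All levels over a sequence of period \<open>m + 1\<close> exceed \<open>m\<close> or are \<open>0\<close>. The \<open>N + 1\<close> points over
  it therefore stay \<open>1 / m\<close>-close for all time.
\<close>

lemma not_n_expansive_stacked: "\<not> n_expansive N stacked_space f"
proof
  assume "n_expansive N stacked_space f"
  then obtain c where c: "c > 0"
    and ball: "\<And>p. p \<in> S \<Longrightarrow>
      finite (dynamical_ball stacked_space f p c) \<and> card (dynamical_ball stacked_space f p c) \<le> N"
    by (auto simp: n_expansive_def)
  obtain m where m: "m \<ge> 1" "1 / real m < c"
    using c by (rule scale_exists)
  define x where "x = (\<lambda>i. int (m + 1) dvd i)"
  define A where "A = insert 0 {m * N + 1..m * N + N}"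
  have code: "(x, a) \<in> codes N" if "a \<in> A" for a
  proof (cases "a = 0")
    case False
    then have "m * N \<le> a - 1" "a - 1 < (m + 1) * N"
      using that by (auto simp: A_def)
    then have "(a - 1) div N = m"
      by (simp add: div_nat_eqI mult.commute)
    then show ?thesis
      using spikes_nonempty[of "m + 1"] by (simp add: codes_def x_def)
  qed (simp add: codes_def)
  define pt where "pt a = (SOME p. p \<in> S \<and> itin p = x \<and> lev p = a)" for a
  have pt: "pt a \<in> S \<and> itin (pt a) = x \<and> lev (pt a) = a" if "a \<in> A" for a
    unfolding pt_def by (rule someI_ex) (metis point_exists[OF code[OF that]])
  have "0 \<in> A"
    by (simp add: A_def)
  have "inj_on pt A"
    by (rule inj_onI) (metis pt)
  have "m * 1 \<le> m * N"
    using N_pos by (rule mult_le_mono2)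
  then have "a = 0 \<or> m < a" if "a \<in> A" for a
    using that unfolding A_def by (simp, linarith)
  then have high: "height m a = 0" if "a \<in> A" for a
    using that by (force simp: height_def)
  have "pt a \<in> dynamical_ball stacked_space f (pt 0) c" if "a \<in> A" for a
  proof -
    have "gap (int_iterate stacked_space f k (pt 0)) (int_iterate stacked_space f k (pt a)) \<le> c" for k
    proof -
      have "near m (int_iterate stacked_space f k (pt 0)) (int_iterate stacked_space f k (pt a))"
        using pt[OF that] pt[OF \<open>0 \<in> A\<close>] high[OF that] high[OF \<open>0 \<in> A\<close>]
        by (simp add: near_def itin_iterate lev_iterate)
      then show ?thesis
        using gap_less_iff[of "int_iterate stacked_space f k (pt 0)" "int_iterate stacked_space f k (pt a)" m]
          m pt[OF that] pt[OF \<open>0 \<in> A\<close>] iterate_in by fastforce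
    qed
    then show ?thesis
      using pt[OF that] by (simp add: dynamical_ball_def)
  qed
  then have "card A \<le> card (dynamical_ball stacked_space f (pt 0) c)"
    using \<open>inj_on pt A\<close> ball pt[OF \<open>0 \<in> A\<close>] by (intro card_inj_on_le) auto
  then have "card A \<le> N"
    using ball pt[OF \<open>0 \<in> A\<close>] order_trans by blast
  then show False
    by (simp add: A_def)
qed

section \<open>Shadowing\<close>

lemma int_step_imp_const:
  assumes "\<And>k::int. g k = g (k + 1)"
  shows "g k = g 0"
proof (induction k rule: int_induct[of _ 0])
  case (step1 i)
  then show ?case using assms[of i] by simp
next
  case (step2 i)
  then show ?case using assms[of "i - 1"] by simp
qed simp

text \<open>
  As in the full shift, each step of a pseudo-orbit moves the window by one place, so the symbol seen
  at position \<open>i\<close> at time \<open>k\<close> arrives at position \<open>0\<close> at time \<open>k + i\<close>, without ever leaving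
  the window on its way.
\<close>

lemma read_ahead:
  assumes step: "\<And>k. near m (f (s k)) (s (k + 1))" and s: "\<And>k. s k \<in> S" and i: "\<bar>i\<bar> < int m"
  shows "itin (s k) i = itin (s (k + i)) 0"
proof -
  have move: "itin (s k) (j + 1) = itin (s (k + 1)) j" if "\<bar>j\<bar> < int m" for k j
    using step[of k] that s by (auto simp: near_def itin_f)
  show ?thesis
    using i
  proof (induction i arbitrary: k rule: int_induct[of _ 0])
    case (step1 i)
    then show ?case
      using move[of i k] step1.IH[of "k + 1"] by (simp add: algebra_simps)
  next
    case (step2 i)
    then show ?case
      using move[of "i - 1" "k - 1"] step2.IH[of "k - 1"] by (simp add: algebra_simps)
  qed simp
qed

text \<open>
  The truncated level is constant along the pseudo-orbit. If it vanishes, then the symbols at position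
  \<open>0\<close> form a shadowing sequence, which is available at level \<open>0\<close>. If it is positive, every jump
  is trivial by \<open>near_imp_eq\<close> and the pseudo-orbit is the orbit of its point at time \<open>0\<close>.
\<close>

lemma near_pseudo_orbit_shadowed:
  assumes step: "\<And>k. near m (f (s k)) (s (k + 1))" and s: "\<And>k. s k \<in> S"
  shows "\<exists>y\<in>S. \<forall>k. near m (int_iterate stacked_space f k y) (s k)"
proof -
  have "height m (lev (s k)) = height m (lev (s (k + 1)))" for k
    using step[of k] s by (simp add: near_def lev_f)
  then have const: "height m (lev (s k)) = height m (lev (s 0))" for k
    by (rule int_step_imp_const)
  show ?thesis
  proof (cases "height m (lev (s 0)) = 0")
    case True
    obtain y where y: "y \<in> S" "itin y = (\<lambda>i. itin (s i) 0)" "lev y = 0"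
      using point_exists[of "\<lambda>i. itin (s i) 0" 0] by (auto simp: codes_def)
    have "near m (int_iterate stacked_space f k y) (s k)" for k
      unfolding near_def
    proof (intro conjI allI impI)
      fix i :: int
      assume "\<bar>i\<bar> < int m"
      with step s have "itin (s k) i = itin (s (k + i)) 0"
        by (rule read_ahead)
      then show "itin (int_iterate stacked_space f k y) i = itin (s k) i"
        using y by (simp add: itin_iterate add.commute)
    next
      show "height m (lev (int_iterate stacked_space f k y)) = height m (lev (s k))"
        using const[of k] True y by (simp add: lev_iterate height_def)
    qed
    then show ?thesis
      using y by blast
  next
    case False
    have lev_s: "1 \<le> lev (s k)" "lev (s k) \<le> m" for k
      using const[of k] False by (auto simp: height_def split: if_splits)
    have orbit: "s (k + 1) = f (s k)" for k
      using near_imp_eq[OF f_in[OF s] s step[of k]] lev_s[of k] s by (simp add: lev_f)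
    have move: "itin (s k) j = itin (s (k + 1)) (j - 1)" for k j
      using orbit[of k] itin_f[OF s, of k "j - 1"] by simp
    \<comment> \<open>Along the moving position \<open>i - k\<close> the symbol does not change.\<close>
    have "itin (s k) (i - k) = itin (s 0) i" for i k
    proof (rule int_step_imp_const[of "\<lambda>k. itin (s k) (i - k)" k, simplified])
      show "itin (s k) (i - k) = itin (s (k + 1)) (i - (k + 1))" for k
        using move[of k "i - k"] by (simp only: diff_diff_eq)
    qed
    then have "itin (s 0) (i + k) = itin (s k) i" for i k
      by (metis add_diff_cancel_right')
    then have "near m (int_iterate stacked_space f k (s 0)) (s k)" for k
      using const[of k] s by (simp add: near_def itin_iterate lev_iterate)
    then show ?thesis
      using s by blast
  qed
qed

lemma shadowing_stacked: "shadowing_property stacked_space f"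
  unfolding shadowing_property_def
proof (intro allI impI)
  fix \<epsilon> :: real
  assume "\<epsilon> > 0"
  then obtain m where m: "m \<ge> 1" "1 / real m < \<epsilon>"
    by (rule scale_exists)
  show "\<exists>\<delta>>0. \<forall>s. pseudo_orbit stacked_space f \<delta> s \<longrightarrow> shadowed stacked_space f \<epsilon> s"
  proof (intro exI[of _ "1 / real m"] conjI allI impI)
    fix s
    assume "pseudo_orbit stacked_space f (1 / real m) s"
    then have s: "\<And>k. s k \<in> S" and "\<And>k. near m (f (s k)) (s (k + 1))"
      using m by (auto simp: pseudo_orbit_def gap_less_iff f_in)
    then obtain y where y: "y \<in> S" "\<And>k. near m (int_iterate stacked_space f k y) (s k)"
      using near_pseudo_orbit_shadowed by blast
    then have "gap (int_iterate stacked_space f k y) (s k) < \<epsilon>" for k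
      using gap_less_iff[of "int_iterate stacked_space f k y" "s k" m] iterate_in s m by fastforce
    then show "shadowed stacked_space f \<epsilon> s"
      using y by (auto simp: shadowed_def)
  qed (use m in simp)
qed

section \<open>Chain-recurrent classes\<close>

text \<open>
  The map preserves levels, and a jump smaller than \<open>1 / a\<close> cannot leave level \<open>a\<close>.
\<close>

lemma chain_keeps_level:
  assumes "chains_to stacked_space f (1 / real (lev p)) p r" "1 \<le> lev p"
  shows "lev r = lev p"
proof -
  obtain k s where s: "finite_pseudo_orbit stacked_space f (1 / real (lev p)) k s" "s 0 = p" "s k = r"
    using assms by (auto simp: chains_to_def)
  have "lev (s i) = lev p" if "i \<le> k" for i
    using that
  proof (induction i)
    case (Suc i)
    have "s i \<in> S" "s (i + 1) \<in> S" "gap (f (s i)) (s (i + 1)) < 1 / real (lev p)"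
      using s Suc by (auto simp: finite_pseudo_orbit_def)
    then have "near (lev p) (f (s i)) (s (i + 1))"
      using gap_less_iff f_in assms by simp
    then show ?case
      using Suc assms \<open>s i \<in> S\<close> by (auto simp: near_def height_def lev_f split: if_splits)
  qed (use s in simp)
  then show ?thesis
    using s by auto
qed

lemma positive_level_chain_recurrent:
  assumes "p \<in> S" "1 \<le> lev p"
  shows "p \<in> chain_recurrent_class stacked_space f p"
proof -
  define q where "q = (lev p - 1) div N + 1"
  have "itin p \<in> spikes q"
    using code_in[OF assms(1)] assms(2) by (auto simp: codes_def q_def)
  then have "itin p (i + int q) = itin p i" for i
    by (rule spikes_cong) simp
  then have "(f ^^ q) p = p"
    using funpow_f[OF assms(1), of q] assms(1) by (intro point_eqI) auto
  then have "chains_to stacked_space f \<epsilon> p p" if "\<epsilon> > 0" for \<epsilon>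
    using that funpow_f[OF assms(1)] unfolding chains_to_def finite_pseudo_orbit_def
    by (intro exI[of _ q] exI[of _ "\<lambda>i. (f ^^ i) p"]) (auto simp: gap_def q_def)
  then show ?thesis
    using assms by (simp add: chain_recurrent_class_def)
qed

lemma infinite_classes_stacked: "infinite (chain_recurrent_class stacked_space f ` S)"
proof -
  have "((\<lambda>i. int (a div N + 1) dvd i), a + 1) \<in> codes N" for a
    using spikes_nonempty[of "a div N + 1"] by (simp add: codes_def)
  then have "\<exists>p. p \<in> S \<and> lev p = a + 1" for a
    by (metis point_exists)
  then obtain p where p: "\<And>a. p a \<in> S \<and> lev (p a) = a + 1"
    by metis
  have "inj (\<lambda>a. chain_recurrent_class stacked_space f (p a))"
  proof (rule injI)
    fix a b
    assume "chain_recurrent_class stacked_space f (p a) = chain_recurrent_class stacked_space f (p b)"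
    then have "p b \<in> chain_recurrent_class stacked_space f (p a)"
      using positive_level_chain_recurrent[of "p b"] p by simp
    then have "chains_to stacked_space f (1 / real (lev (p a))) (p a) (p b)"
      using p by (simp add: chain_recurrent_class_def)
    then have "lev (p b) = lev (p a)"
      using p by (intro chain_keeps_level) simp_all
    then show "a = b"
      using p by simp
  qed
  then have "infinite (range (\<lambda>a. chain_recurrent_class stacked_space f (p a)))"
    by (simp add: finite_image_iff)
  then show ?thesis
    by (rule infinite_super[rotated]) (use p in blast)
qed

end

section \<open>Realization with real labels\<close>

text \<open>
  A code is a subset of a countable set: the positions of \<open>True\<close> together with one marker for the
  level. There are only continuum many of these.
\<close>

lemma codes_inject_real: "\<exists>e :: (int \<Rightarrow> bool) \<times> nat \<Rightarrow> real. inj e"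
proof -
  obtain h :: "nat set \<Rightarrow> real" where h: "inj h"
    using nat_sets_eqpoll_reals unfolding eqpoll_def bij_betw_def by blast
  define g :: "(int \<Rightarrow> bool) \<times> nat \<Rightarrow> (int + nat) set"
    where "g = (\<lambda>(x, a). Inl ` Collect x \<union> {Inr a})"
  have "inj g"
  proof (rule injI)
    fix c c' :: "(int \<Rightarrow> bool) \<times> nat"
    assume eq: "g c = g c'"
    obtain x a y b where c: "c = (x, a)" "c' = (y, b)"
      by (metis surj_pair)
    have "Inl i \<in> g c \<longleftrightarrow> x i" "Inl i \<in> g c' \<longleftrightarrow> y i"
      "Inr j \<in> g c \<longleftrightarrow> j = a" "Inr j \<in> g c' \<longleftrightarrow> j = b" for i j
      by (auto simp: g_def c)
    then show "c = c'"
      using eq c by auto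
  qed
  moreover have "inj (\<lambda>A :: (int + nat) set. to_nat ` A)"
    by (intro injI) (simp add: inj_image_eq_iff)
  ultimately have "inj (h \<circ> (\<lambda>A. to_nat ` A) \<circ> g)"
    using h by (intro inj_compose)
  then show ?thesis
    by blast
qed

theorem theorem1:
  fixes n :: nat
  assumes "n \<ge> 2"
  shows "\<exists>(X :: real metric) (f :: real \<Rightarrow> real).
           compact_space (mtopology_of X) \<and>
           homeomorphism_of X f \<and>
           n_expansive n X f \<and>
           \<not> n_expansive (n - 1) X f \<and>
           shadowing_property X f \<and>
           infinite (chain_recurrent_class X f ` mspace X)"
proof -
  obtain e :: "(int \<Rightarrow> bool) \<times> nat \<Rightarrow> real" where e: "inj e"
    using codes_inject_real by blast
  let ?d = "inv e"
  define f where "f r = e (\<lambda>i. fst (?d r) (i + 1), snd (?d r))" for r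
  interpret stacked_shift "n - 1" "e ` codes (n - 1)" "\<lambda>r. fst (?d r)" "\<lambda>r. snd (?d r)" f
  proof
    show "n - 1 \<ge> 1"
      using assms by simp
    show "bij_betw (\<lambda>r. (fst (?d r), snd (?d r))) (e ` codes (n - 1)) (codes (n - 1))"
      using e by (auto simp: bij_betw_def inj_on_def image_image)
    show "f r \<in> e ` codes (n - 1)" if "r \<in> e ` codes (n - 1)" for r
      using that e spikes_shift[of _ _ 1] by (auto simp: f_def codes_def)
  qed (use e in \<open>auto simp: f_def\<close>)
  have "n - 1 + 1 = n"
    using assms by simp
  then have "n_expansive n stacked_space f"
    using n_expansive_stacked by metis
  moreover have "compact_space (mtopology_of stacked_space)" "homeomorphism_of stacked_space f"
    unfolding homeomorphism_of_def mtopology_stacked_space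
    by (rule compact_mtopology homeomorphic_map_f)+
  ultimately show ?thesis
    using not_n_expansive_stacked shadowing_stacked infinite_classes_stacked
    by (intro exI[of _ stacked_space] exI[of _ f]) (unfold mspace_stacked_space, blast)
qed

end
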